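(* Let $q$ be a prime power and let $1\le m\leq m'$ be integers. Let $\mathcal{C}\subseteq\mathbb{F}_q^{m\times m'}$ be a rank-metric code of size $q^s$ and minimum distance $m$. Then the covering radius $\rho(\mathcal{C})$ is lower bounded by $m-h$, where $h$ is the smallest non-negative integer that satisfies $$(h+1)^2+(m'-m)(h+1)-(s+\log_q(4))>0.$$ In particular, if $q\neq 2,3$, then $$\rho(\mathcal{C})\geq m-\sqrt{s+1}.$$
   Context: A rank-metric code is a (not necessarily linear) subset $\mathcal{C}\subseteq\mathbb{F}_q^{m\times m'}$ with $|\mathcal{C}|\geq2$; its minimum distance is $\min\{\mathrm{rank}(A-B): A,B\in\mathcal{C},\ A\neq B\}$. Its covering radius is $\rho(\mathcal{C})=\max\{\min\{\mathrm{rank}(A-Y):A\in\mathcal{C}\}: Y\in\mathbb{F}_q^{m\times m'}\}$. *)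

theory Defs
  imports "HOL-Analysis.Analysis"
begin

(* Matrices over the finite field 'a with CARD('m) rows and CARD('n) columns have type
   'a^'n^'m; rank is the library rank over an arbitrary field.
   The Min/Max below range over finite sets because the matrix type is finite, and over
   nonempty ones whenever C satisfies rank_metric_code. *)

definition rank_metric_code :: "(('a::{field,finite})^'n^'m) set \<Rightarrow> bool" where
  "rank_metric_code C \<longleftrightarrow> card C \<ge> 2"

definition min_rank_distance :: "(('a::{field,finite})^'n^'m) set \<Rightarrow> nat" where
  "min_rank_distance C = Min {rank (A - B) | A B. A \<in> C \<and> B \<in> C \<and> A \<noteq> B}"

definition covering_radius :: "(('a::{field,finite})^'n^'m) set \<Rightarrow> nat" where
  "covering_radius C = Max {Min {rank (A - Y) | A. A \<in> C} | Y. Y \<in> UNIV}"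

end

theory Submission
  imports Defs
begin

text \<open>This is the sphere-covering bound. Balls of radius \<open>\<rho>(C)\<close> around the codewords cover the
  space, so it suffices that there are at most \<open>4 q\<^bsup>r(m + m' - r)\<^esup>\<close> matrices of rank at most
  \<open>r\<close>. To see this, place the row space of such a matrix in a subspace \<open>W\<close> of dimension exactly
  \<open>r\<close>, and count pairs of a matrix and an ordered basis of its \<open>W\<close>: each matrix occurs in
  \<open>|GL\<^sub>r(q)| \<ge> q\<^bsup>r\<^sup>2\<^esup> / 4\<close> pairs, and each list of \<open>r\<close> vectors in at most \<open>q\<^bsup>rm\<^esup>\<close> pairs.\<close>

section \<open>Counting vectors and independent lists over a finite field\<close>

lemma card_span_insert:
  fixes a :: "'a::{field,finite}^'n"
  assumes "a \<notin> vec.span S"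
  shows "card (vec.span (insert a S)) = CARD('a) * card (vec.span S)"
proof -
  let ?f = "\<lambda>(c, x). c *s a + x"
  have "inj_on ?f (UNIV \<times> vec.span S)"
  proof (rule inj_onI, clarsimp)
    fix c d x y
    assume x: "x \<in> vec.span S" and y: "y \<in> vec.span S" and eq: "c *s a + x = d *s a + y"
    have "(c - d) *s a = y - x"
      using eq by (simp add: algebra_simps)
    then have "(c - d) *s a \<in> vec.span S"
      using x y vec.span_diff by metis
    \<comment> \<open>Distinct scalars could be cancelled here, which would put \<open>a\<close>
      into the old span.\<close>
    then have "inverse (c - d) *s ((c - d) *s a) \<in> vec.span S"
      by (rule vec.span_scale)
    then have "c = d"
      using assms
      by (cases "c = d") (simp_all del: vector_ssub_ldistrib vector_sub_rdistrib)
    then show "c = d \<and> x = y"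
      using eq by simp
  qed
  moreover have "?f ` (UNIV \<times> vec.span S) = vec.span (insert a S)"
  proof (intro equalityI subsetI)
    fix y assume "y \<in> ?f ` (UNIV \<times> vec.span S)"
    then obtain c x where "x \<in> vec.span S" "y = c *s a + x"
      by auto
    then have "y - c *s a \<in> vec.span S"
      by simp
    then show "y \<in> vec.span (insert a S)"
      unfolding vec.span_breakdown_eq ..
  next
    fix y assume "y \<in> vec.span (insert a S)"
    then obtain c where "y - c *s a \<in> vec.span S"
      unfolding vec.span_breakdown_eq ..
    then show "y \<in> ?f ` (UNIV \<times> vec.span S)"
      by (intro image_eqI[of _ _ "(c, y - c *s a)"]) auto
  qed
  ultimately show ?thesis
    by (metis card_cartesian_product card_image)
qed

lemma card_span_independent:
  fixes S :: "('a::{field,finite}^'n) set"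
  assumes "vec.independent S"
  shows "card (vec.span S) = CARD('a) ^ card S"
proof -
  have "finite S"
    by simp
  then show ?thesis
    using assms
  proof (induction S rule: finite_induct)
    case empty
    then show ?case
      by simp
  next
    case (insert a S)
    then show ?case
      by (simp add: vec.independent_insert card_span_insert)
  qed
qed

text \<open>Distinctness is asked for separately because \<open>set xs\<close> forgets repetitions.
  If \<open>k\<close> is the dimension of the subspace \<open>W\<close>, these are its ordered
  bases.\<close>

definition independent_lists :: "('a::{field,finite}^'n) set \<Rightarrow> nat \<Rightarrow> ('a^'n) list set" where
  "independent_lists W k =
    {xs. length xs = k \<and> set xs \<subseteq> W \<and> distinct xs \<and> vec.independent (set xs)}"

lemma finite_independent_lists: "finite (independent_lists W k)"
  by (rule finite_subset[OF _ finite_lists_length_eq[of UNIV k]])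
    (auto simp: independent_lists_def)

lemma card_span_independent_list:
  fixes W :: "('a::{field,finite}^'n) set"
  assumes "xs \<in> independent_lists W k"
  shows "card (vec.span (set xs)) = CARD('a) ^ k"
  using assms by (auto simp: independent_lists_def card_span_independent distinct_card)

text \<open>Build a list one vector at a time: an independent list of length \<open>i\<close> spans
  \<open>q^i\<close> vectors, and each of the other \<open>q^r - q^i\<close> vectors of
  \<open>W\<close> may be prepended.\<close>

lemma card_independent_lists:
  fixes W :: "('a::{field,finite}^'n) set"
  assumes W: "vec.subspace W" "card W = CARD('a) ^ r" and "k \<le> r"
  shows "real (card (independent_lists W k)) = (\<Prod>i<k. real CARD('a) ^ r - real CARD('a) ^ i)"
  using \<open>k \<le> r\<close>
proof (induction k)
  case 0
  have "independent_lists W 0 = {[]}"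
    by (auto simp: independent_lists_def vec.independent_empty)
  then show ?case
    by simp
next
  case (Suc k)
  let ?P = "SIGMA xs : independent_lists W k. W - vec.span (set xs)"
  have "independent_lists W (Suc k) = (\<lambda>(xs, x). x # xs) ` ?P"
  proof (intro equalityI subsetI)
    fix ys assume "ys \<in> independent_lists W (Suc k)"
    then obtain x xs where "ys = x # xs" "(xs, x) \<in> ?P"
      by (cases ys) (auto simp: independent_lists_def vec.independent_insert)
    then show "ys \<in> (\<lambda>(xs, x). x # xs) ` ?P"
      by force
  next
    fix ys assume "ys \<in> (\<lambda>(xs, x). x # xs) ` ?P"
    then show "ys \<in> independent_lists W (Suc k)"
      by (auto simp: independent_lists_def vec.span_base dest: vec.dependent_insertD)
  qed
  moreover have "inj_on (\<lambda>(xs, x). x # xs) ?P"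
    by (auto simp: inj_on_def)
  ultimately have "card (independent_lists W (Suc k)) = card ?P"
    by (simp add: card_image)
  also have "\<dots> = (\<Sum>xs\<in>independent_lists W k. card (W - vec.span (set xs)))"
    by (rule card_SigmaI) (auto simp: finite_independent_lists)
  also have "\<dots> = (\<Sum>xs\<in>independent_lists W k. CARD('a) ^ r - CARD('a) ^ k)"
  proof (rule sum.cong[OF refl])
    fix xs assume xs: "xs \<in> independent_lists W k"
    then have "vec.span (set xs) \<subseteq> W"
      using W(1) by (intro vec.span_minimal) (auto simp: independent_lists_def)
    then show "card (W - vec.span (set xs)) = CARD('a) ^ r - CARD('a) ^ k"
      using card_span_independent_list[OF xs] W(2) by (simp add: card_Diff_subset)
  qed
  finally have "card (independent_lists W (Suc k)) =
      card (independent_lists W k) * (CARD('a) ^ r - CARD('a) ^ k)"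
    by simp
  \<comment> \<open>This turns the truncated subtraction of naturals into the real one.\<close>
  moreover have "CARD('a) ^ k \<le> CARD('a) ^ r"
    using Suc.prems by (intro power_increasing) (auto simp: Suc_le_eq)
  ultimately show ?case
    using Suc by simp
qed

section \<open>A lower bound for the order of the general linear group\<close>

text \<open>Divided by \<open>q^(r * r)\<close>, the product is that of \<open>1 - q^(-j)\<close>
  for \<open>1 \<le> j \<le> r\<close>. It decreases in \<open>r\<close>, so a constant lower bound
  is not inductive by itself.\<close>

lemma prod_order_GL_ge:
  fixes q :: real
  assumes "q \<ge> 2"
  shows "q ^ (r * r) \<le> 4 * (\<Prod>i<r. q ^ r - q ^ i)"
proof (cases "r = 0")
  case False
  txt \<open>The stronger bound with the factor \<open>1 + 2 / q\<^sup>r\<close> survives the induction.\<close>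
  have "q ^ (r * r) * (q ^ r + 2) \<le> 4 * (\<Prod>i<r. q ^ r - q ^ i) * q ^ r"
    if "r \<ge> 1" for r
    using that
  proof (induction r rule: dec_induct)
    case base
    \<comment> \<open>Four times the product, minus \<open>q * (q + 2)\<close>; it vanishes at
      \<open>q = 2\<close>.\<close>
    have "0 \<le> q * (3 * q - 6)"
      using assms by simp
    then show ?case
      by (simp add: algebra_simps)
  next
    case (step r)
    define Q where "Q = q ^ r"
    define G where "G = (\<Prod>i<r. Q - q ^ i)"
    \<comment> \<open>True only from \<open>r = 1\<close> on, hence the start of the induction
      there.\<close>
    have Q: "Q \<ge> 2"
      using assms step.hyps power_increasing[of 1 r q] by (simp add: Q_def)
    \<comment> \<open>Split off the factor for \<open>i = 0\<close> and take \<open>q\<close> out of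
      each of the others.\<close>
    have "(\<Prod>i<Suc r. q ^ Suc r - q ^ i) = (q * Q - 1) * (\<Prod>i<r. q * (Q - q ^ i))"
      by (subst prod.lessThan_Suc_shift) (simp add: Q_def algebra_simps)
    also have "\<dots> = (q * Q - 1) * Q * G"
      by (simp add: prod.distrib G_def Q_def)
    finally have G': "(\<Prod>i<Suc r. q ^ Suc r - q ^ i) = (q * Q - 1) * Q * G" .
    have pow: "q ^ (Suc r * Suc r) = q ^ (r * r) * Q * Q * q"
      by (simp add: Q_def power_add algebra_simps flip: power_mult)
    have IH: "q ^ (r * r) * (Q + 2) \<le> 4 * G * Q"
      using step.IH by (simp add: Q_def G_def)
    \<comment> \<open>The goal is \<open>1 + 2/(q*Q) \<le> (1 - 1/(q*Q)) * (1 + 2/Q)\<close> with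
      denominators cleared: the correction factor absorbs the new factor of the product. The
      difference of the two sides is at least \<open>Q - 2\<close>.\<close>
    have "Q * 2 \<le> Q * q"
      using assms Q by (intro mult_left_mono) auto
    moreover have "(q * Q - 1) * (Q + 2) - Q * (q * Q + 2) = 2 * (Q * q) - 3 * Q - 2"
      by (simp add: algebra_simps)
    ultimately have le: "Q * (q * Q + 2) \<le> (q * Q - 1) * (Q + 2)"
      using Q by linarith
    have "q * Q \<ge> 1"
      using assms Q mult_mono[of 1 q 1 Q] by simp
    have "q ^ (Suc r * Suc r) * (q ^ Suc r + 2) = q ^ (r * r) * Q * q * (Q * (q * Q + 2))"
      unfolding pow by (simp add: Q_def)
    also have "\<dots> \<le> q ^ (r * r) * Q * q * ((q * Q - 1) * (Q + 2))"
      using le assms Q by (intro mult_left_mono) auto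
    also have "\<dots> = (q * Q - 1) * Q * q * (q ^ (r * r) * (Q + 2))"
      by simp
    also have "\<dots> \<le> (q * Q - 1) * Q * q * (4 * G * Q)"
      using IH assms Q \<open>q * Q \<ge> 1\<close> by (intro mult_left_mono) auto
    also have "\<dots> = 4 * (\<Prod>i<Suc r. q ^ Suc r - q ^ i) * q ^ Suc r"
      unfolding G' by (simp add: Q_def)
    finally show ?case .
  qed
  from this[of r] have "q ^ (r * r) * (q ^ r + 2) \<le> 4 * (\<Prod>i<r. q ^ r - q ^ i) * q ^ r"
    using False by simp
  moreover have "q ^ (r * r) * q ^ r \<le> q ^ (r * r) * (q ^ r + 2)"
    using assms by (intro mult_left_mono) auto
  ultimately have "q ^ (r * r) * q ^ r \<le> 4 * (\<Prod>i<r. q ^ r - q ^ i) * q ^ r"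
    by linarith
  then show ?thesis
    using assms by (simp add: mult_le_cancel_right)
qed simp

section \<open>Counting matrices of bounded rank\<close>

text \<open>Extend a basis of the row space to a basis of the whole space and keep \<open>r\<close>
  of its vectors, including the original ones. The dimension is exactly \<open>r\<close> so that all
  matrices get equal weight in the double count.\<close>

lemma obtain_subspace_rows:
  fixes A :: "'a::{field,finite}^'n^'m"
  assumes "rank A \<le> r" "r \<le> CARD('n)"
  obtains W where "vec.subspace W" "card W = CARD('a) ^ r" "rows A \<subseteq> W"
proof -
  obtain B where B: "B \<subseteq> rows A" "vec.independent B" "rows A \<subseteq> vec.span B"
    "card B = vec.dim (rows A)"
    using vec.basis_exists[of "rows A"] by blast
  obtain B' where B': "B \<subseteq> B'" "B' \<subseteq> UNIV" "vec.independent B'" "UNIV \<subseteq> vec.span B'"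
    by (rule vec.maximal_independent_subset_extend[OF subset_UNIV B(2)])
  have "card B' = vec.dim (UNIV :: ('a^'n) set)"
    using B'(2-4) by (intro vec.basis_card_eq_dim)
  then have "card B' = CARD('n)"
    by (simp add: card_cart_basis)
  moreover have "card B \<le> r"
    using assms(1) B(4) by (simp add: row_rank_def_gen)
  ultimately obtain S where S: "B \<subseteq> S" "S \<subseteq> B'" "card S = r"
    using exists_subset_between[of B r B'] B'(1) assms(2) by auto
  show ?thesis
  proof
    show "vec.subspace (vec.span S)"
      by (rule vec.subspace_span)
    show "card (vec.span S) = CARD('a) ^ r"
      using card_span_independent[OF vec.independent_mono[OF B'(3) S(2)]] S(3) by simp
    show "rows A \<subseteq> vec.span S"
      using B(3) vec.span_mono[OF S(1)] by blast
  qed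
qed

lemma card_matrices_rows_in:
  fixes W :: "('a::finite^'n) set"
  shows "card {A :: 'a^'n^'m. rows A \<subseteq> W} \<le> card W ^ CARD('m)"
proof -
  have "vec_nth ` {A :: 'a^'n^'m. rows A \<subseteq> W} \<subseteq> UNIV \<rightarrow>\<^sub>E W"
    by (auto simp: rows_def row_def)
  moreover have "inj_on vec_nth {A :: 'a^'n^'m. rows A \<subseteq> W}"
    by (auto simp: inj_on_def vec_nth_inject)
  ultimately have "card {A :: 'a^'n^'m. rows A \<subseteq> W} \<le> card (UNIV \<rightarrow>\<^sub>E W :: ('m \<Rightarrow> 'a^'n) set)"
    by (metis card_image card_mono finite)
  then show ?thesis
    by (simp add: card_PiE)
qed

lemma CARD_field_ge_2: "CARD('a::{field,finite}) \<ge> 2"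
  using card_mono[of UNIV "{0, 1 :: 'a}"] by simp

text \<open>The factor \<open>q^(r * r)\<close> stays on the left to avoid a subtraction in the
  exponent.\<close>

lemma card_rank_ball_le:
  assumes "r \<le> CARD('n)"
  shows "real (card {A :: 'a::{field,finite}^'n^'m. rank A \<le> r}) * real CARD('a) ^ (r * r)
    \<le> 4 * real CARD('a) ^ (r * (CARD('m) + CARD('n)))"
proof -
  let ?q = "real CARD('a)"
  define B where "B = {A :: 'a^'n^'m. rank A \<le> r}"
  define G where "G = (\<Prod>i<r. ?q ^ r - ?q ^ i)"
  have "\<exists>W. vec.subspace W \<and> card W = CARD('a) ^ r \<and> rows A \<subseteq> W" if "A \<in> B" for A
    using obtain_subspace_rows[of A r] that assms by (auto simp: B_def)
  then obtain W where W: "\<And>A. A \<in> B \<Longrightarrow> vec.subspace (W A)"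
    "\<And>A. A \<in> B \<Longrightarrow> card (W A) = CARD('a) ^ r" "\<And>A. A \<in> B \<Longrightarrow> rows A \<subseteq> W A"
    by metis
  let ?P = "SIGMA A : B. independent_lists (W A) r"
  let ?R = "SIGMA xs : independent_lists UNIV r. {A :: 'a^'n^'m. rows A \<subseteq> vec.span (set xs)}"
  have sub: "(\<lambda>(A, xs). (xs, A)) ` ?P \<subseteq> ?R"
  proof clarsimp
    fix A xs assume A: "A \<in> B" and xs: "xs \<in> independent_lists (W A) r"
    \<comment> \<open>Inclusion and equal cardinality show that the list determines
      \<open>W A\<close>; hence \<open>?R\<close> can range over all lists without mentioning
      \<open>W\<close>.\<close>
    have "vec.span (set xs) \<subseteq> W A"
      using W(1)[OF A] xs by (intro vec.span_minimal) (auto simp: independent_lists_def)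
    then have "vec.span (set xs) = W A"
      using card_span_independent_list[OF xs] W(2)[OF A] by (intro card_subset_eq) auto
    then show "xs \<in> independent_lists UNIV r \<and> rows A \<subseteq> vec.span (set xs)"
      using W(3)[OF A] xs by (auto simp: independent_lists_def)
  qed
  have "inj_on (\<lambda>(A, xs). (xs, A)) ?P"
    by (auto simp: inj_on_def)
  then have "card ?P \<le> card ?R"
    using sub by (intro card_inj_on_le[OF _ sub]) (auto simp: finite_independent_lists)
  also have "\<dots> = (\<Sum>xs\<in>independent_lists UNIV r.
      card {A :: 'a^'n^'m. rows A \<subseteq> vec.span (set xs)})"
    by (rule card_SigmaI) (auto simp: finite_independent_lists)
  also have "\<dots> \<le> (\<Sum>xs\<in>independent_lists (UNIV :: ('a^'n) set) r. (CARD('a) ^ r) ^ CARD('m))"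
  proof (rule sum_mono)
    fix xs :: "('a^'n) list"
    assume "xs \<in> independent_lists UNIV r"
    then show "card {A :: 'a^'n^'m. rows A \<subseteq> vec.span (set xs)} \<le> (CARD('a) ^ r) ^ CARD('m)"
      using card_matrices_rows_in[of "vec.span (set xs)"] by (simp add: card_span_independent_list)
  qed
  also have "\<dots> = card (independent_lists (UNIV :: ('a^'n) set) r) * (CARD('a) ^ r) ^ CARD('m)"
    by simp
  \<comment> \<open>Crude count of all lists of length \<open>r\<close>, independent or not.\<close>
  also have "card (independent_lists (UNIV :: ('a^'n) set) r) \<le> (CARD('a) ^ CARD('n)) ^ r"
  proof -
    have "card (independent_lists (UNIV :: ('a^'n) set) r)
        \<le> card {xs :: ('a^'n) list. set xs \<subseteq> UNIV \<and> length xs = r}"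
      by (intro card_mono finite_lists_length_eq) (auto simp: independent_lists_def)
    then show ?thesis
      by (subst (asm) card_lists_length_eq) simp_all
  qed
  finally have "card ?P \<le> (CARD('a) ^ CARD('n)) ^ r * (CARD('a) ^ r) ^ CARD('m)"
    by simp
  then have "real (card ?P) \<le> real ((CARD('a) ^ CARD('n)) ^ r * (CARD('a) ^ r) ^ CARD('m))"
    by (simp only: of_nat_le_iff)
  also have "\<dots> = ?q ^ (r * (CARD('m) + CARD('n)))"
    by (simp add: power_add algebra_simps flip: power_mult)
  finally have "real (card ?P) \<le> ?q ^ (r * (CARD('m) + CARD('n)))" .
  \<comment> \<open>The same pairs sorted by matrix: each \<open>W A\<close> has \<open>G\<close>
    ordered bases.\<close>
  moreover have "real (card ?P) = real (card B) * G"
  proof -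
    have "card ?P = (\<Sum>A\<in>B. card (independent_lists (W A) r))"
      by (rule card_SigmaI) (auto simp: finite_independent_lists)
    then have "real (card ?P) = (\<Sum>A\<in>B. real (card (independent_lists (W A) r)))"
      by simp
    also have "\<dots> = (\<Sum>A\<in>B. G)"
      using W by (intro sum.cong refl) (simp add: card_independent_lists G_def)
    finally show ?thesis
      by simp
  qed
  moreover have "real (card B) * ?q ^ (r * r) \<le> real (card B) * (4 * G)"
    using prod_order_GL_ge[of ?q r] CARD_field_ge_2[where 'a='a]
    by (intro mult_left_mono) (simp_all add: G_def)
  ultimately show ?thesis
    unfolding B_def by linarith
qed

section \<open>Sphere covering and the resulting inequality of exponents\<close>

lemma covering_radius_attained:
  fixes C :: "('a::{field,finite}^'n^'m) set"
  assumes "C \<noteq> {}"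
  obtains A where "A \<in> C" "rank (A - Y) \<le> covering_radius C"
proof -
  have "Min {rank (A - Y) | A. A \<in> C} \<in> {rank (A - Y) | A. A \<in> C}"
    using assms by (intro Min_in) auto
  moreover have "Min {rank (A - Y) | A. A \<in> C} \<le> covering_radius C"
    unfolding covering_radius_def by (intro Max_ge) (auto simp: full_SetCompr_eq)
  ultimately show ?thesis
    using that by auto
qed

lemma sphere_covering_bound:
  fixes C :: "('a::{field,finite}^'n^'m) set"
  assumes "C \<noteq> {}" "covering_radius C \<le> r"
  shows "CARD('a) ^ (CARD('m) * CARD('n)) \<le> card C * card {A :: 'a^'n^'m. rank A \<le> r}"
proof -
  have "UNIV \<subseteq> (\<lambda>(A, E). A - E) ` (C \<times> {A :: 'a^'n^'m. rank A \<le> r})"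
  proof
    fix Y :: "'a^'n^'m"
    obtain A where "A \<in> C" "rank (A - Y) \<le> r"
      using covering_radius_attained[OF assms(1), of Y] assms(2) order_trans by metis
    then show "Y \<in> (\<lambda>(A, E). A - E) ` (C \<times> {A. rank A \<le> r})"
      by (intro image_eqI[of _ _ "(A, A - Y)"]) auto
  qed
  then have "CARD('a^'n^'m) \<le> card (C \<times> {A :: 'a^'n^'m. rank A \<le> r})"
    by (intro surj_card_le) auto
  then show ?thesis
    by (simp add: card_cartesian_product mult.commute flip: power_mult)
qed

text \<open>Take logarithms to base \<open>q\<close> in the sphere-covering bound; with
  \<open>m\<close> rows and \<open>n\<close> columns, \<open>m * n - r * (m + n - r)\<close> factors
  as \<open>(m - r) * (n - r)\<close>. The radius \<open>r\<close> may exceed the covering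
  radius.\<close>

lemma covering_radius_exponent_bound:
  fixes C :: "('a::{field,finite}^'n^'m) set"
  assumes "real (card C) = real CARD('a) powr s"
    and "covering_radius C \<le> r" "r \<le> CARD('n)"
  shows "(real CARD('m) - real r) * (real CARD('n) - real r) \<le> s + log (real CARD('a)) 4"
proof -
  let ?q = "real CARD('a)" and ?m = "CARD('m)" and ?n = "CARD('n)"
  have q: "?q > 1"
    using CARD_field_ge_2[where 'a='a] by simp
  have C: "C \<noteq> {}"
    using assms(1) q by auto
  have "?q ^ (?m * ?n) \<le> real (card C) * real (card {A :: 'a^'n^'m. rank A \<le> r})"
    using sphere_covering_bound[OF C assms(2)] by (metis of_nat_le_iff of_nat_mult of_nat_power)
  then have "?q ^ (?m * ?n) * ?q ^ (r * r)
      \<le> real (card C) * real (card {A :: 'a^'n^'m. rank A \<le> r}) * ?q ^ (r * r)"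
    by (intro mult_right_mono) auto
  also have "\<dots> \<le> real (card C) * (4 * ?q ^ (r * (?m + ?n)))"
    using card_rank_ball_le[OF assms(3), where 'a='a and 'm='m]
    by (simp add: mult.assoc mult_left_mono)
  finally have "?q ^ (?m * ?n + r * r) \<le> ?q powr s * (4 * ?q ^ (r * (?m + ?n)))"
    by (simp add: power_add assms(1))
  then have "log ?q (?q ^ (?m * ?n + r * r)) \<le> log ?q (?q powr s * (4 * ?q ^ (r * (?m + ?n))))"
    using q by (subst log_le_cancel_iff) auto
  then have "real (?m * ?n + r * r) \<le> s + log ?q 4 + real (r * (?m + ?n))"
    using q by (simp add: log_mult log_nat_power)
  then show ?thesis
    by (simp add: algebra_simps)
qed

theorem theorem6p7:
  fixes C :: "(('a::{field,finite})^'n^'m) set"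
    and q m m' :: nat and s :: real
  assumes "q = CARD('a)" and "m = CARD('m)" and "m' = CARD('n)"
    and "m \<le> m'"
    and "rank_metric_code C"
    and "real (card C) = real q powr s"
    and "min_rank_distance C = m"
  shows "real (covering_radius C) \<ge> real m - real (LEAST h::nat.
           (real h + 1)^2 + (real m' - real m) * (real h + 1) - (s + log (real q) 4) > 0)
         \<and> (q \<noteq> 2 \<and> q \<noteq> 3 \<longrightarrow> real (covering_radius C) \<ge> real m - sqrt (s + 1))"
proof -
  define P where "P h \<longleftrightarrow>
    (real h + 1)^2 + (real m' - real m) * (real h + 1) - (s + log (real q) 4) > 0" for h :: nat
  define h where "h = (LEAST h. P h)"
  have q: "q \<ge> 2"
    using CARD_field_ge_2[where 'a='a] assms(1) by simp
  have s: "s \<ge> 0"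
  proof (rule ccontr)
    assume "\<not> s \<ge> 0"
    then have "real q powr s \<le> real q powr 0"
      using q by (intro powr_mono) auto
    then show False
      using assms(5,6) q by (simp add: rank_metric_code_def)
  qed
  \<comment> \<open>Some witness of \<open>P\<close> is needed for the \<open>LEAST\<close> to be
    meaningful; this one works since \<open>(k + 1)^2 > k\<close>.\<close>
  obtain k where k: "real k \<ge> s + log (real q) 4"
    using real_arch_simple by blast
  have "P k"
  proof -
    have "(real k + 1)^2 \<ge> real k + 1"
      by (simp add: power2_eq_square)
    moreover have "(real m' - real m) * (real k + 1) \<ge> 0"
      using assms(4) by simp
    ultimately show ?thesis
      using k by (simp add: P_def)
  qed
  then have h: "P h"
    unfolding h_def by (rule LeastI)
  have radius: "real (covering_radius C) \<ge> real m - real h"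
  proof (rule ccontr)
    assume "\<not> ?thesis"
    then have "covering_radius C + h + 1 \<le> m"
      by linarith
    \<comment> \<open>With \<open>r = m - h - 1\<close> the factors are \<open>m - r = h + 1\<close>
      and \<open>m' - r = (h + 1) + (m' - m)\<close>; their product is the leading part of
      \<open>P h\<close>.\<close>
    then obtain r where r: "m = r + h + 1" "covering_radius C \<le> r"
      by (metis add.assoc le_Suc_ex le_add2 add.commute)
    have "r \<le> CARD('n)"
      using r(1) assms(3,4) by simp
    from covering_radius_exponent_bound[OF assms(6)[unfolded assms(1)] r(2) this]
    have "(real m - real r) * (real m' - real r) \<le> s + log (real q) 4"
      by (simp add: assms(1-3))
    moreover have "(real m - real r) * (real m' - real r)
        = (real h + 1)^2 + (real m' - real m) * (real h + 1)"
      by (simp add: r(1) power2_eq_square algebra_simps)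
    ultimately show False
      using h by (simp add: P_def)
  qed
  moreover have "real h \<le> sqrt (s + 1)" if "q \<noteq> 2" "q \<noteq> 3"
  proof (cases h)
    case 0
    then show ?thesis
      using s by simp
  next
    case (Suc k)
    \<comment> \<open>Minimality of \<open>h\<close> at its predecessor \<open>k\<close>; the shift
      \<open>k + 1\<close> in \<open>P\<close> makes the failed inequality one about
      \<open>h\<close> itself.\<close>
    then have "\<not> P k"
      unfolding h_def by (intro not_less_Least) simp
    then have "(real h)^2 + (real m' - real m) * real h \<le> s + log (real q) 4"
      by (simp add: P_def Suc add.commute)
    moreover have "(real m' - real m) * real h \<ge> 0"
      using assms(4) by simp
    \<comment> \<open>Excluding 2 and 3 leaves \<open>q \<ge> 4\<close>.\<close>
    moreover have "log (real q) 4 \<le> 1"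
      using q that by simp
    ultimately have "(real h)^2 \<le> s + 1"
      by linarith
    then show ?thesis
      by (rule real_le_rsqrt)
  qed
  ultimately show ?thesis
    unfolding h_def P_def by force
qed

end
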